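(* Let $n\ge 1$. For any $v\in\mathbb{H}^n$ we have $\mathcal{H}(v)=B(v)$, i.e. the algebraic hull of $v$ equals its enveloping multisphere.
   Context: $\mathbb{H}$ is Hamilton's algebra of real quaternions. $R=\mathbb{H}[x_1,\dots,x_n]$ is the ring of polynomials in $n$ central variables: the variables commute with each other and with all coefficients. For $f=\sum a_{i_1,\dots,i_n}x_1^{i_1}\cdots x_n^{i_n}\in R$ (coefficients on the left) and any $a=(a_1,\dots,a_n)\in\mathbb{H}^n$, define $f(a)=\sum a_{i_1,\dots,i_n}a_1^{i_1}\cdots a_n^{i_n}$ (products in this order). For $I\subseteq R$, $\mathcal{V}(I)=\{a\in\mathbb{H}^n : f(a)=0 \text{ for all } f\in I\}$. The algebraic hull of $v\in\mathbb{H}^n$ is $\mathcal{H}(v)=\bigcap_{I}\mathcal{V}(I)$, the intersection over all left ideals $I$ of $R$ with $v\in\mathcal{V}(I)$. For $m\ge1$, $\mathbb{H}^m_c=\{(q_1,\dots,q_m)\in\mathbb{H}^m : q_iq_j=q_jq_i \text{ for all } i,j\}$. For $w=(q_1,\dots,q_m)\in\mathbb{H}^m$, $\mathbb{S}_w=\{(qq_1q^{-1},\dots,qq_mq^{-1}) : q\in\mathbb{H}\setminus\{0\}\}$. Central presentation: every $v\in\mathbb{H}^n$ can be written uniquely as a concatenation $v=(v_0,\dots,v_r)$ with $r\ge 0$, $v_i=(v_{i,1},\dots,v_{i,k_i})\in\mathbb{H}^{k_i}_c$, $k_i\ge1$, $\sum_{i=0}^r k_i=n$, such that $(v_{i,k_i},v_{i+1})\notin\mathbb{H}^{k_{i+1}+1}_c$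 for all $0\le i\le r-1$. The enveloping multisphere of $v$ is $B(v)=\{v_0\}\times\mathbb{S}_{v_1}\times\cdots\times\mathbb{S}_{v_r}\subseteq\mathbb{H}^n$. *)

theory Defs
  imports Complex_Main "HOL-Library.Poly_Mapping"
begin

section \<open>Quaternions\<close>

datatype quat = Quat (qRe: real) (qI: real) (qJ: real) (qK: real)

instantiation quat :: division_ring
begin

definition zero_quat :: quat where "0 = Quat 0 0 0 0"

definition one_quat :: quat where "1 = Quat 1 0 0 0"

definition plus_quat :: "quat \<Rightarrow> quat \<Rightarrow> quat" where
  "p + q = Quat (qRe p + qRe q) (qI p + qI q) (qJ p + qJ q) (qK p + qK q)"

definition uminus_quat :: "quat \<Rightarrow> quat" where
  "- q = Quat (- qRe q) (- qI q) (- qJ q) (- qK q)"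

definition minus_quat :: "quat \<Rightarrow> quat \<Rightarrow> quat" where
  "p - q = Quat (qRe p - qRe q) (qI p - qI q) (qJ p - qJ q) (qK p - qK q)"

definition times_quat :: "quat \<Rightarrow> quat \<Rightarrow> quat" where
  "p * q = Quat
    (qRe p * qRe q - qI p * qI q - qJ p * qJ q - qK p * qK q)
    (qRe p * qI q + qI p * qRe q + qJ p * qK q - qK p * qJ q)
    (qRe p * qJ q - qI p * qK q + qJ p * qRe q + qK p * qI q)
    (qRe p * qK q + qI p * qJ q - qJ p * qI q + qK p * qRe q)"

text \<open>The inverse is the conjugate divided by the squared norm; it maps \<open>0\<close> to \<open>0\<close>.\<close>

definition inverse_quat :: "quat \<Rightarrow> quat" where
  "inverse q = (let N = (qRe q)\<^sup>2 + (qI q)\<^sup>2 + (qJ q)\<^sup>2 + (qK q)\<^sup>2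
                in Quat (qRe q / N) (- qI q / N) (- qJ q / N) (- qK q / N))"

definition divide_quat :: "quat \<Rightarrow> quat \<Rightarrow> quat" where
  "p div q = p * inverse (q :: quat)"

lemmas quat_ops_defs = zero_quat_def one_quat_def plus_quat_def uminus_quat_def minus_quat_def
  times_quat_def

lemma quat_left_inverse:
  fixes q :: quat
  assumes "q \<noteq> 0"
  shows "inverse q * q = 1"
proof -
  obtain a b c d where q: "q = Quat a b c d" by (cases q)
  define N where "N = a\<^sup>2 + b\<^sup>2 + c\<^sup>2 + d\<^sup>2"
  have "a \<noteq> 0 \<or> b \<noteq> 0 \<or> c \<noteq> 0 \<or> d \<noteq> 0"
    using assms by (auto simp: q zero_quat_def)
  then have "N \<noteq> 0"
    unfolding N_def by (smt (verit) zero_less_power2 zero_le_power2)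
  moreover have "a * a + b * b + c * c + d * d = N"
    by (simp add: N_def power2_eq_square)
  then have "a * a / N + b * b / N + c * c / N + d * d / N = N / N"
    by (simp flip: add_divide_distrib)
  ultimately show ?thesis
    by (simp add: q inverse_quat_def times_quat_def one_quat_def Let_def flip: N_def)
qed

lemma quat_right_inverse:
  fixes q :: quat
  assumes "q \<noteq> 0"
  shows "q * inverse q = 1"
  using quat_left_inverse[OF assms]
  by (cases q) (simp add: inverse_quat_def times_quat_def one_quat_def Let_def algebra_simps)

instance
proof
  show "a * b * c = a * (b * c)" for a b c :: quat
    by (simp add: quat_ops_defs algebra_simps)
  show "inverse (0::quat) = 0"
    by (simp add: inverse_quat_def zero_quat_def)
  show "inverse q * q = 1" if "q \<noteq> 0" for q :: quat
    using that by (rule quat_left_inverse)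
  show "q * inverse q = 1" if "q \<noteq> 0" for q :: quat
    using that by (rule quat_right_inverse)
  show "p div q = p * inverse q" for p q :: quat
    by (rule divide_quat_def)
qed (simp_all add: quat_ops_defs algebra_simps)

end

lemma hamilton_relations:
  fixes i j k :: quat
  defines "i \<equiv> Quat 0 1 0 0" and "j \<equiv> Quat 0 0 1 0" and "k \<equiv> Quat 0 0 0 1"
  shows "i * i = - 1" "j * j = - 1" "k * k = - 1" "i * j * k = - 1"
  by (simp_all add: i_def j_def k_def quat_ops_defs)


section \<open>Polynomials in central variables, evaluation, left ideals\<close>

text \<open>
  An exponent vector is a finitely supported map from variable indices to naturals, and
  multiplication of polynomials is convolution of the coefficients. Hence variables commute with
  each other and with coefficients. Indices run over \<open>{0..<n}\<close>, so the \<open>i\<close>-th variable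
  of the mathematical text has index \<open>i - 1\<close>; points of the \<open>n\<close>-dimensional affine
  space are lists of length \<open>n\<close>.
\<close>

type_synonym qpoly = "(nat \<Rightarrow>\<^sub>0 nat) \<Rightarrow>\<^sub>0 quat"

definition poly_ring :: "nat \<Rightarrow> qpoly set" where
  "poly_ring n = {f. \<forall>m \<in> Poly_Mapping.keys f. Poly_Mapping.keys m \<subseteq> {..<n}}"

definition tuples :: "nat \<Rightarrow> quat list set" where
  "tuples n = {a. length a = n}"

definition eval_poly :: "nat \<Rightarrow> qpoly \<Rightarrow> quat list \<Rightarrow> quat" where
  "eval_poly n f a =
    (\<Sum>m \<in> Poly_Mapping.keys f. Poly_Mapping.lookup f m *
       prod_list (map (\<lambda>i. (a ! i) ^ Poly_Mapping.lookup m i) [0..<n]))"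

definition zero_locus :: "nat \<Rightarrow> qpoly set \<Rightarrow> quat list set" where
  "zero_locus n I = {a \<in> tuples n. \<forall>f \<in> I. eval_poly n f a = 0}"

definition left_ideal :: "nat \<Rightarrow> qpoly set \<Rightarrow> bool" where
  "left_ideal n I \<longleftrightarrow>
     I \<subseteq> poly_ring n \<and> 0 \<in> I \<and> (\<forall>f \<in> I. \<forall>g \<in> I. f + g \<in> I) \<and>
     (\<forall>g \<in> poly_ring n. \<forall>f \<in> I. g * f \<in> I)"

definition algebraic_hull :: "nat \<Rightarrow> quat list \<Rightarrow> quat list set" where
  "algebraic_hull n v = (\<Inter>I \<in> {I. left_ideal n I \<and> v \<in> zero_locus n I}. zero_locus n I)"


section \<open>Central presentation and enveloping multisphere\<close>

definition commuting_tuples :: "nat \<Rightarrow> quat list set" where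
  "commuting_tuples m = {w \<in> tuples m. \<forall>i < m. \<forall>j < m. w ! i * w ! j = w ! j * w ! i}"

definition sphere_of :: "quat list \<Rightarrow> quat list set" where
  "sphere_of w = {map (\<lambda>x. q * x * inverse q) w | q. q \<noteq> 0}"

definition central_presentation :: "quat list \<Rightarrow> quat list list \<Rightarrow> bool" where
  "central_presentation v vs \<longleftrightarrow>
     vs \<noteq> [] \<and> concat vs = v \<and>
     (\<forall>w \<in> set vs. length w \<ge> 1 \<and> w \<in> commuting_tuples (length w)) \<and>
     (\<forall>i. i + 1 < length vs \<longrightarrow>
        last (vs ! i) # vs ! (i + 1) \<notin> commuting_tuples (length (vs ! (i + 1)) + 1))"

lemma commuting_tuples_length_iff:
  "w \<in> commuting_tuples (length w) \<longleftrightarrow> (\<forall>x \<in> set w. \<forall>y \<in> set w. x * y = y * x)"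
  unfolding commuting_tuples_def tuples_def by (auto simp: all_set_conv_all_nth)

lemma commuting_tuples_Cons_iff:
  "x # w \<in> commuting_tuples (length w + 1) \<longleftrightarrow>
     (\<forall>y \<in> set (x # w). \<forall>z \<in> set (x # w). y * z = z * y)"
  using commuting_tuples_length_iff[of "x # w"] by simp

lemma central_presentation_iff:
  "central_presentation v vs \<longleftrightarrow>
     vs \<noteq> [] \<and> concat vs = v \<and>
     (\<forall>w \<in> set vs. w \<noteq> [] \<and> (\<forall>x \<in> set w. \<forall>y \<in> set w. x * y = y * x)) \<and>
     (\<forall>i. Suc i < length vs \<longrightarrow> (\<exists>y \<in> set (vs ! Suc i). last (vs ! i) * y \<noteq> y * last (vs ! i)))"
  (is "?L \<longleftrightarrow> ?R")
proof -
  have block: "a # w \<notin> commuting_tuples (length w + 1) \<longleftrightarrow> (\<exists>y \<in> set w. a * y \<noteq> y * a)"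
    if "\<forall>x \<in> set w. \<forall>y \<in> set w. x * y = y * x" for a :: quat and w
  proof
    assume "a # w \<notin> commuting_tuples (length w + 1)"
    then obtain y z where yz: "y = a \<or> y \<in> set w" "z = a \<or> z \<in> set w" "y * z \<noteq> z * y"
      unfolding commuting_tuples_Cons_iff by auto
    show "\<exists>y \<in> set w. a * y \<noteq> y * a"
    proof (rule ccontr)
      assume "\<not> ?thesis"
      then have c: "a * x = x * a" if "x \<in> set w" for x using that by blast
      from yz(1,2) have "y * z = z * y"
        by (elim disjE) (use that c in \<open>simp_all\<close>)
      with yz(3) show False ..
    qed
  next
    assume "\<exists>y \<in> set w. a * y \<noteq> y * a"
    then show "a # w \<notin> commuting_tuples (length w + 1)"
      unfolding commuting_tuples_Cons_iff by auto
  qed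
  show ?thesis
  proof (cases "\<forall>w \<in> set vs. \<forall>x \<in> set w. \<forall>y \<in> set w. x * y = y * x")
    case True
    have "last (vs ! i) # vs ! (i + 1) \<notin> commuting_tuples (length (vs ! (i + 1)) + 1) \<longleftrightarrow>
        (\<exists>y \<in> set (vs ! Suc i). last (vs ! i) * y \<noteq> y * last (vs ! i))"
      if "Suc i < length vs" for i
      using block[of "vs ! Suc i" "last (vs ! i)"] True nth_mem[OF that] by simp
    then have "(\<forall>i. i + 1 < length vs \<longrightarrow>
          last (vs ! i) # vs ! (i + 1) \<notin> commuting_tuples (length (vs ! (i + 1)) + 1)) \<longleftrightarrow>
        (\<forall>i. Suc i < length vs \<longrightarrow> (\<exists>y \<in> set (vs ! Suc i). last (vs ! i) * y \<noteq> y * last (vs ! i)))"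
      by simp
    moreover have "(\<forall>w \<in> set vs. length w \<ge> 1 \<and> w \<in> commuting_tuples (length w)) \<longleftrightarrow>
        (\<forall>w \<in> set vs. w \<noteq> [] \<and> (\<forall>x \<in> set w. \<forall>y \<in> set w. x * y = y * x))"
      by (simp add: commuting_tuples_length_iff Suc_le_eq)
    ultimately show ?thesis
      unfolding central_presentation_def by (simp only:)
  next
    case False
    then show ?thesis
      unfolding central_presentation_def commuting_tuples_length_iff by blast
  qed
qed

lemma central_presentation_snoc:
  "central_presentation v (vs @ [w]) \<longleftrightarrow>
     w \<noteq> [] \<and> (\<forall>x \<in> set w. \<forall>y \<in> set w. x * y = y * x) \<and>
     ((vs = [] \<and> v = w) \<or>
      (\<exists>u. v = u @ w \<and> central_presentation u vs \<and> (\<exists>y \<in> set w. last u * y \<noteq> y * last u)))"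
proof (cases "vs = []")
  case True
  then show ?thesis
    by (auto simp: central_presentation_iff)
next
  case False
  then obtain vs' z where vs: "vs = vs' @ [z]"
    by (metis rev_exhaust)
  have split: "(\<forall>i. Suc i < length (vs @ [w]) \<longrightarrow> P ((vs @ [w]) ! i) ((vs @ [w]) ! Suc i)) \<longleftrightarrow>
     (\<forall>i. Suc i < length vs \<longrightarrow> P (vs ! i) (vs ! Suc i)) \<and> P z w" (is "?A \<longleftrightarrow> ?B") for P
  proof
    assume A: ?A
    show ?B
    proof
      show "\<forall>i. Suc i < length vs \<longrightarrow> P (vs ! i) (vs ! Suc i)"
      proof (intro allI impI)
        fix i assume "Suc i < length vs"
        then show "P (vs ! i) (vs ! Suc i)"
          using A[rule_format, of i] by (simp add: nth_append)
      qed
      show "P z w"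
        using A[rule_format, of "length vs'"] by (simp add: vs nth_append)
    qed
  next
    assume B: ?B
    show ?A
    proof (intro allI impI)
      fix i assume i: "Suc i < length (vs @ [w])"
      show "P ((vs @ [w]) ! i) ((vs @ [w]) ! Suc i)"
      proof (cases "Suc i < length vs")
        case True
        then show ?thesis using B by (simp add: nth_append)
      next
        case False
        then have "i = length vs'" using i by (simp add: vs)
        then show ?thesis using B by (simp add: vs nth_append)
      qed
    qed
  qed
  have "last (concat vs) = last z" if "z \<noteq> []"
    using that by (simp add: vs)
  then show ?thesis
    unfolding central_presentation_iff split[of "\<lambda>a b. \<exists>y\<in>set b. last a * y \<noteq> y * last a"]
    using False by (auto simp: vs)
qed

text \<open>
  Blocks are determined from the right: the last one is the longest suffix whose entries commute
  pairwise.
\<close>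

theorem central_presentation_exists_unique:
  assumes "v \<noteq> []"
  shows "\<exists>!vs. central_presentation v vs"
  using assms
proof (induction "length v" arbitrary: v rule: less_induct)
  case less
  let ?C = "\<lambda>w. \<forall>x \<in> set w. \<forall>y \<in> set w. x * y = y * (x::quat)"
  let ?S = "\<lambda>k. k < length v \<and> ?C (drop k v)"
  define k where "k = (LEAST k. ?S k)"
  have "?S (length v - 1)"
  proof -
    have "drop (length v - 1) v = [last v]"
      using less.prems by (metis append_butlast_last_id append_eq_conv_conj length_butlast)
    then show ?thesis using less.prems by simp
  qed
  then have k: "?S k"
    unfolding k_def by (rule LeastI)
  have k_le: "k \<le> l" if "?S l" for l
    unfolding k_def using that by (rule Least_le)
  have last_block: "u = take k v \<and> w = drop k v"
    if v: "v = u @ w" and w: "w \<noteq> []" "?C w" and m: "u = [] \<or> (\<exists>y \<in> set w. last u * y \<noteq> y * last u)"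
    for u w
  proof -
    have "k \<le> length u" using v w by (intro k_le) auto
    moreover have "\<not> k < length u"
    proof
      assume *: "k < length u"
      then have "drop k v = drop k u @ w" using v by simp
      moreover have "last u \<in> set (drop k u)"
        using * by (metis drop_eq_Nil last_drop last_in_set not_le)
      ultimately show False using k m * by auto
    qed
    ultimately have "k = length u" by simp
    then show ?thesis using v by simp
  qed
  show ?case
  proof (cases "k = 0")
    case True
    have "vs = [v]" if cp: "central_presentation v vs" for vs
    proof -
      obtain vs' w where vs: "vs = vs' @ [w]"
        using cp unfolding central_presentation_def by (metis rev_exhaust)
      consider "vs' = []" "v = w"
        | u where "v = u @ w" "central_presentation u vs'" "\<exists>y \<in> set w. last u * y \<noteq> y * last u"
        using cp unfolding vs central_presentation_snoc by blast
      then show ?thesis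
      proof cases
        case 1 then show ?thesis using vs by simp
      next
        case 2
        have "w \<noteq> []" "?C w" using cp unfolding vs central_presentation_snoc by blast+
        then have "u = []" using last_block[of u w] 2 True by simp
        then show ?thesis using 2 by (auto simp: central_presentation_iff)
      qed
    qed
    moreover have "central_presentation v [v]"
      using k True less.prems by (auto simp: central_presentation_iff)
    ultimately show ?thesis by blast
  next
    case False
    define u where "u = take k v"
    define w where "w = drop k v"
    have v: "v = u @ w" and w: "w \<noteq> []" "?C w" and u: "u \<noteq> []" "length u < length v"
      using k False less.prems by (auto simp: u_def w_def)
    have nc: "\<exists>y \<in> set w. last u * y \<noteq> y * last u"
    proof (rule ccontr)
      assume neg: "\<not> ?thesis"
      have "drop (k - 1) v = last u # w"
      proof -
        have "v = butlast u @ last u # w" using v u by simp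
        moreover have "length (butlast u) = k - 1" using k by (simp add: u_def)
        ultimately show ?thesis by (metis append_eq_conv_conj)
      qed
      then have "?S (k - 1)" using neg w k False by auto
      then show False using k_le[of "k - 1"] False by simp
    qed
    obtain us where us: "central_presentation u us" and us_uniq: "\<And>xs. central_presentation u xs \<Longrightarrow> xs = us"
      using less.hyps[OF u(2) u(1)] by blast
    have "vs = us @ [w]" if cp: "central_presentation v vs" for vs
    proof -
      obtain vs' w' where vs: "vs = vs' @ [w']"
        using cp unfolding central_presentation_def by (metis rev_exhaust)
      have w': "w' \<noteq> []" "?C w'" using cp unfolding vs central_presentation_snoc by blast+
      consider "vs' = []" "v = w'"
        | u' where "v = u' @ w'" "central_presentation u' vs'" "\<exists>y \<in> set w'. last u' * y \<noteq> y * last u'"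
        using cp unfolding vs central_presentation_snoc by blast
      then show ?thesis
      proof cases
        case 1
        then show ?thesis using last_block[of "[]" w'] w' u by (simp add: u_def)
      next
        case 2
        then have "u' = u" "w' = w" using last_block[of u' w'] w' by (auto simp: u_def w_def)
        then show ?thesis using 2 us_uniq vs by simp
      qed
    qed
    moreover have "central_presentation v (us @ [w])"
      unfolding central_presentation_snoc using v w us nc by blast
    ultimately show ?thesis by blast
  qed
qed

text \<open>
  \<^term>\<open>listset\<close> is the cartesian product of a list of sets, here with values in lists of
  blocks; concatenating the blocks gives points of the affine space.
\<close>

definition enveloping_multisphere :: "quat list \<Rightarrow> quat list set" where
  "enveloping_multisphere v =
     (let vs = (THE vs. central_presentation v vs)
      in concat ` listset ({hd vs} # map sphere_of (tl vs)))"

end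

theory Submission
  imports Defs
begin

text \<open>
  A polynomial \<open>f = \<Sum>\<^sub>m c\<^sub>m x\<^sup>m\<close> vanishes at \<open>a\<close> iff it is annihilated by the left linear functional
  that sends \<open>x\<^sup>m\<close> to the ordered product \<open>a\<^sup>m\<close>. So \<open>a\<close> lies in the hull of \<open>v\<close> iff every left ideal
  annihilated by the functional of \<open>v\<close> is annihilated by the functional of \<open>a\<close>. Both inclusions
  compare such functionals.

  \<^bold>\<open>The multisphere lies in the hull.\<close> The functionals \<open>\<phi>\<close> that annihilate a left ideal form a right
  vector space over the quaternions, and this space is closed under the shift
  \<open>m \<mapsto> \<phi> (m + k)\<close>, because the ideal is closed under multiplication by \<open>x\<^sup>k\<close>. Cut \<open>v\<close> between two
  consecutive blocks of its central presentation and write \<open>v\<^sup>m = A(m) B(m)\<close> accordingly. Raising the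
  exponent of the last variable on the left of the cut multiplies \<open>A\<close> on the right by the last entry
  \<open>u\<close>, whatever \<open>m\<close> is; raising the exponent of a variable of the next block multiplies \<open>B\<close> on the
  left by its entry \<open>w\<close>, because the block commutes. Shifts thus insert \<open>u\<close>, \<open>w\<close> and \<open>u w\<close> at the cut.
  The central presentation provides a \<open>w\<close> that does not commute with \<open>u\<close>, and then
  \<open>1, u, w, u w\<close> span the quaternions over the reals (\<open>noncommuting_quats_span\<close>), so that
  \<open>A(m) p B(m)\<close> annihilates the ideal for every quaternion \<open>p\<close> (\<open>annihilates_insert\<close>). Doing this at
  all cuts, from right to left, allows independent quaternions \<open>p\<^sub>1, \<dots>, p\<^sub>r\<close> in front of the blocks
  \<open>1, \<dots>, r\<close>, and suitable choices turn these blocks into arbitrary conjugates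
  (\<open>annihilates_spheres\<close>).

  \<^bold>\<open>The hull lies in the multisphere.\<close> Take the largest left ideal that vanishes at \<open>v\<close>. It contains
  every polynomial in the variables of one block that vanishes there, provided that its coefficients
  are real or that the block is the first one: its value can then be factored out of the ordered
  products. The polynomials \<open>x\<^sub>i - v\<^sub>i\<close> determine the first block of a point of the hull. In
  a later block the real relations \<open>x\<^sup>2 - 2 Re(w) x + |w|\<^sup>2 = 0\<close> for a nonreal entry \<open>w\<close> and
  \<open>y = \<alpha> + \<beta> x\<close> for the other entries force simultaneous conjugacy
  (\<open>hull_relation\<close>, \<open>in_sphere_if_relations\<close>).
\<close>

section \<open>Quaternions\<close>

abbreviation real_quat :: "real \<Rightarrow> quat" where
  "real_quat r \<equiv> Quat r 0 0 0"

lemma real_quat_commute: "real_quat r * p = p * real_quat r"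
  by (simp add: times_quat_def)

lemma real_quat_commute_left: "p * (real_quat r * q) = real_quat r * (p * q)"
  by (simp add: times_quat_def algebra_simps)

text \<open>
  Up to real summands, \<open>u w\<close> is a combination of \<open>u\<close>, \<open>w\<close> and the cross product of the vector
  parts of \<open>u\<close> and \<open>w\<close>. That cross product is nonzero exactly when \<open>u\<close> and \<open>w\<close> do not commute, so
  then it and the two vector parts form a basis of the imaginary quaternions.
\<close>
lemma noncommuting_quats_span:
  fixes u w p :: quat
  assumes "u * w \<noteq> w * u"
  obtains a b c d where
    "p = real_quat a + real_quat b * u + real_quat c * w + real_quat d * (u * w)"
proof -
  obtain u0 u1 u2 u3 where u: "u = Quat u0 u1 u2 u3" by (cases u)
  obtain w0 w1 w2 w3 where w: "w = Quat w0 w1 w2 w3" by (cases w)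
  obtain p0 p1 p2 p3 where p: "p = Quat p0 p1 p2 p3" by (cases p)
  \<comment> \<open>\<open>(x, y, z)\<close> is the cross product of the vector parts, and \<open>b'\<close>, \<open>c'\<close>, \<open>d\<close> are the coordinates
    of the vector part of \<open>p\<close>, given by Cramer's rule.\<close>
  define x where "x = u2 * w3 - u3 * w2"
  define y where "y = u3 * w1 - u1 * w3"
  define z where "z = u1 * w2 - u2 * w1"
  define N where "N = x * x + y * y + z * z"
  have "x \<noteq> 0 \<or> y \<noteq> 0 \<or> z \<noteq> 0"
    using assms by (auto simp: u w x_def y_def z_def times_quat_def algebra_simps)
  then have N: "N \<noteq> 0"
    unfolding N_def by (smt (verit) not_real_square_gt_zero zero_le_square)
  define d where "d = (p1 * x + p2 * y + p3 * z) / N"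
  define b' where "b' = (p1 * (w2 * z - w3 * y) + p2 * (w3 * x - w1 * z) + p3 * (w1 * y - w2 * x)) / N"
  define c' where "c' = (p1 * (y * u3 - z * u2) + p2 * (z * u1 - x * u3) + p3 * (x * u2 - y * u1)) / N"
  have 1: "b' * u1 + c' * w1 + d * x = p1"
  proof -
    have "(b' * u1 + c' * w1 + d * x) * N = p1 * N"
      unfolding b'_def c'_def d_def using N
      by (simp add: add_divide_distrib[symmetric]) (simp add: N_def x_def y_def z_def, algebra)
    then show ?thesis using N by simp
  qed
  have 2: "b' * u2 + c' * w2 + d * y = p2"
  proof -
    have "(b' * u2 + c' * w2 + d * y) * N = p2 * N"
      unfolding b'_def c'_def d_def using N
      by (simp add: add_divide_distrib[symmetric]) (simp add: N_def x_def y_def z_def, algebra)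
    then show ?thesis using N by simp
  qed
  have 3: "b' * u3 + c' * w3 + d * z = p3"
  proof -
    have "(b' * u3 + c' * w3 + d * z) * N = p3 * N"
      unfolding b'_def c'_def d_def using N
      by (simp add: add_divide_distrib[symmetric]) (simp add: N_def x_def y_def z_def, algebra)
    then show ?thesis using N by simp
  qed
  \<comment> \<open>Passing from the cross product to \<open>u * w\<close> adds \<open>w0\<close> times the vector part of \<open>u\<close> and \<open>u0\<close>
    times that of \<open>w\<close>, which is subtracted here.\<close>
  define b where "b = b' - d * w0"
  define c where "c = c' - d * u0"
  define a where "a = p0 - b * u0 - c * w0 - d * (u0 * w0 - u1 * w1 - u2 * w2 - u3 * w3)"
  have "p = real_quat a + real_quat b * u + real_quat c * w + real_quat d * (u * w)"
    using 1 2 3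
    by (simp add: u w p a_def b_def c_def x_def y_def z_def times_quat_def plus_quat_def algebra_simps)
  then show thesis by (rule that)
qed

text \<open>
  Commuting quaternions have parallel vector parts: the centralizer of a nonreal quaternion is a
  copy of the complex numbers.
\<close>
lemma commuting_with_nonreal:
  fixes u x :: quat
  assumes "u * x = x * u" and "u \<noteq> real_quat (qRe u)"
  obtains \<alpha> \<beta> where "x = real_quat \<alpha> + real_quat \<beta> * u"
proof -
  obtain u0 u1 u2 u3 where u: "u = Quat u0 u1 u2 u3" by (cases u)
  obtain x0 x1 x2 x3 where x: "x = Quat x0 x1 x2 x3" by (cases x)
  have c: "u2 * x3 = u3 * x2" "u3 * x1 = u1 * x3" "u1 * x2 = u2 * x1"
    using assms(1) by (auto simp: u x times_quat_def algebra_simps)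
  consider "u1 \<noteq> 0" | "u2 \<noteq> 0" | "u3 \<noteq> 0"
    using assms(2) by (auto simp: u)
  then obtain \<beta> where "x1 = \<beta> * u1" "x2 = \<beta> * u2" "x3 = \<beta> * u3"
  proof cases
    case 1
    show ?thesis by (rule that[of "x1 / u1"]) (use 1 c in \<open>simp_all add: field_simps\<close>)
  next
    case 2
    show ?thesis by (rule that[of "x2 / u2"]) (use 2 c in \<open>simp_all add: field_simps\<close>)
  next
    case 3
    show ?thesis by (rule that[of "x3 / u3"]) (use 3 c in \<open>simp_all add: field_simps\<close>)
  qed
  then have "x = real_quat (x0 - \<beta> * u0) + real_quat \<beta> * u"
    by (simp add: u x times_quat_def plus_quat_def)
  then show thesis by (rule that)
qed

abbreviation sq_norm :: "quat \<Rightarrow> real" where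
  "sq_norm q \<equiv> (qRe q)\<^sup>2 + (qI q)\<^sup>2 + (qJ q)\<^sup>2 + (qK q)\<^sup>2"

lemma quat_quadratic:
  "q * q + real_quat (- 2 * qRe q) * q + real_quat (sq_norm q) = 0"
  by (cases q) (simp add: quat_ops_defs power2_eq_square)

text \<open>
  A root has the same real part and norm as the nonreal \<open>w\<close>, and these two numbers determine the
  conjugacy class.
\<close>
lemma conjugate_if_root:
  fixes x w :: quat
  assumes w: "w \<noteq> real_quat (qRe w)"
    and root: "x * x + real_quat (- 2 * qRe w) * x + real_quat (sq_norm w) = 0"
  obtains q where "q \<noteq> 0" and "x = q * w * inverse q"
proof -
  obtain w0 w1 w2 w3 where W: "w = Quat w0 w1 w2 w3" by (cases w)
  obtain x0 x1 x2 x3 where X: "x = Quat x0 x1 x2 x3" by (cases x)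
  have eqs: "x0 * x0 - x1 * x1 - x2 * x2 - x3 * x3 - 2 * w0 * x0 + (w0\<^sup>2 + w1\<^sup>2 + w2\<^sup>2 + w3\<^sup>2) = 0"
    "(x0 - w0) * x1 = 0" "(x0 - w0) * x2 = 0" "(x0 - w0) * x3 = 0"
    using root by (auto simp: W X quat_ops_defs algebra_simps)
  have pos: "w1\<^sup>2 + w2\<^sup>2 + w3\<^sup>2 > 0"
    using w by (auto simp: W) (smt (verit) zero_less_power2 zero_le_power2)+
  have x0: "x0 = w0"
  proof (rule ccontr)
    assume "x0 \<noteq> w0"
    then have "(x0 - w0)\<^sup>2 + (w1\<^sup>2 + w2\<^sup>2 + w3\<^sup>2) = 0"
      using eqs by (simp add: power2_eq_square algebra_simps)
    then show False using pos by (smt (verit) zero_le_power2)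
  qed
  have norm: "x1\<^sup>2 + x2\<^sup>2 + x3\<^sup>2 = w1\<^sup>2 + w2\<^sup>2 + w3\<^sup>2"
    using eqs(1) by (simp add: x0 power2_eq_square)
  \<comment> \<open>For imaginary \<open>X\<close> and \<open>W\<close> of equal norm, \<open>X\<^sup>2 = W\<^sup>2\<close>, hence \<open>(X + W) W = X (X + W)\<close>. If \<open>X = - W\<close>,
    any nonzero vector orthogonal to \<open>W\<close> anticommutes with it and serves instead.\<close>
  obtain q where q: "q \<noteq> 0" "q * w = x * q"
  proof (cases "x1 = - w1 \<and> x2 = - w2 \<and> x3 = - w3")
    case False
    show ?thesis
    proof (rule that[of "Quat 0 (x1 + w1) (x2 + w2) (x3 + w3)"])
      show "Quat 0 (x1 + w1) (x2 + w2) (x3 + w3) \<noteq> 0"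
        using False by (auto simp: zero_quat_def)
      show "Quat 0 (x1 + w1) (x2 + w2) (x3 + w3) * w = x * Quat 0 (x1 + w1) (x2 + w2) (x3 + w3)"
        using norm by (simp add: W X x0 times_quat_def power2_eq_square algebra_simps)
    qed
  next
    case antipodal: True
    show ?thesis
    proof (cases "w1 = 0 \<and> w2 = 0")
      case False
      show ?thesis
        by (rule that[of "Quat 0 (- w2) w1 0"])
          (use False antipodal in \<open>auto simp: W X x0 quat_ops_defs algebra_simps\<close>)
    next
      case True
      show ?thesis
        by (rule that[of "Quat 0 1 0 0"]) (use True antipodal in \<open>auto simp: W X x0 quat_ops_defs\<close>)
    qed
  qed
  have "x = q * w * inverse q"
    using q by (simp add: mult.assoc)
  with q(1) show thesis by (rule that)
qed

lemma conj_power: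
  fixes q x :: quat
  assumes "q \<noteq> 0"
  shows "(q * x * inverse q) ^ k = q * x ^ k * inverse q"
proof (induction k)
  case 0
  show ?case using assms by simp
next
  case (Suc k)
  have "(q * x * inverse q) ^ Suc k = (q * x * inverse q) * (q * x ^ k * inverse q)"
    by (simp only: power_Suc Suc)
  also have "\<dots> = q * x * (inverse q * q) * x ^ k * inverse q"
    by (simp only: mult.assoc)
  also have "\<dots> = q * x ^ Suc k * inverse q"
    using assms by (simp add: mult.assoc)
  finally show ?case .
qed


section \<open>Ordered products\<close>

definition ordered_product :: "quat list \<Rightarrow> (nat \<Rightarrow> nat) \<Rightarrow> quat" where
  "ordered_product a e = prod_list (map (\<lambda>i. (a ! i) ^ e i) [0..<length a])"

lemma ordered_product_Nil [simp]: "ordered_product [] e = 1"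
  by (simp add: ordered_product_def)

lemma ordered_product_Cons:
  "ordered_product (x # a) e = x ^ e 0 * ordered_product a (\<lambda>i. e (Suc i))"
proof -
  have "[0..<length (x # a)] = 0 # map Suc [0..<length a]"
    by (simp add: upt_conv_Cons map_Suc_upt del: upt_Suc)
  then show ?thesis
    by (simp add: ordered_product_def comp_def del: upt_Suc)
qed

lemma ordered_product_append:
  "ordered_product (a @ b) e = ordered_product a e * ordered_product b (\<lambda>i. e (length a + i))"
  by (induction a arbitrary: e) (simp_all add: ordered_product_Cons mult.assoc)

lemma ordered_product_cong:
  "(\<And>i. i < length a \<Longrightarrow> e i = e' i) \<Longrightarrow> ordered_product a e = ordered_product a e'"
  unfolding ordered_product_def by (intro arg_cong[where f = prod_list] map_cong) auto

lemma ordered_product_zero [simp]: "ordered_product a (\<lambda>i. 0) = 1"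
  by (induction a) (simp_all add: ordered_product_Cons)

lemma ordered_product_conj:
  assumes "q \<noteq> 0"
  shows "ordered_product (map (\<lambda>x. q * x * inverse q) a) e = q * ordered_product a e * inverse q"
proof (induction a arbitrary: e)
  case Nil
  show ?case using assms by simp
next
  case (Cons x a)
  have "ordered_product (map (\<lambda>x. q * x * inverse q) (x # a)) e
      = (q * x ^ e 0 * inverse q) * (q * ordered_product a (\<lambda>i. e (Suc i)) * inverse q)"
    by (simp only: list.map ordered_product_Cons Cons conj_power[OF assms])
  also have "\<dots> = q * x ^ e 0 * (inverse q * q) * ordered_product a (\<lambda>i. e (Suc i)) * inverse q"
    by (simp only: mult.assoc)
  also have "\<dots> = q * ordered_product (x # a) e * inverse q"
    using assms by (simp add: ordered_product_Cons mult.assoc)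
  finally show ?case .
qed

text \<open>
  The last factor stands at the right end of the product, so its exponent can be raised without any
  commutation assumption. This makes the last entry before a cut special.
\<close>
lemma ordered_product_raise_last:
  assumes "a \<noteq> []"
  shows "ordered_product a (e(length a - 1 := Suc (e (length a - 1)))) = ordered_product a e * last a"
proof -
  define b where "b = butlast a"
  have a: "a = b @ [last a]" using assms by (simp add: b_def)
  have "ordered_product b (e(length b := k)) = ordered_product b e" for k
    by (rule ordered_product_cong) simp
  then show ?thesis
    by (subst (1 2 3 4) a)
       (simp add: ordered_product_append ordered_product_Cons power_Suc2 mult.assoc del: power_Suc)
qed

lemma ordered_product_raise_commuting:
  assumes "\<And>x y. x \<in> set w \<Longrightarrow> y \<in> set w \<Longrightarrow> x * y = y * x" and "i < length w"
  shows "ordered_product w (e(i := e i + c)) = (w ! i) ^ c * ordered_product w e"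
  using assms
proof (induction w arbitrary: e i)
  case Nil
  then show ?case by simp
next
  case (Cons x w)
  show ?case
  proof (cases i)
    case 0
    then show ?thesis by (simp add: ordered_product_Cons power_add power_commutes add.commute mult.assoc)
  next
    case (Suc j)
    have j: "j < length w" using Cons.prems(2) Suc by simp
    have IH: "ordered_product w ((\<lambda>i. e (Suc i))(j := e (Suc j) + c))
        = (w ! j) ^ c * ordered_product w (\<lambda>i. e (Suc i))"
      by (rule Cons.IH) (use Cons.prems(1) j in auto)
    have "(\<lambda>k. (e(i := e i + c)) (Suc k)) = (\<lambda>i. e (Suc i))(j := e (Suc j) + c)"
      by (auto simp: Suc)
    moreover have "(e(i := e i + c)) 0 = e 0"
      by (simp add: Suc)
    ultimately have "ordered_product (x # w) (e(i := e i + c))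
        = x ^ e 0 * ((w ! j) ^ c * ordered_product w (\<lambda>i. e (Suc i)))"
      by (simp only: ordered_product_Cons IH)
    moreover have "x * (w ! j) = (w ! j) * x"
      using Cons.prems(1)[of x "w ! j"] j by simp
    then have "x ^ e 0 * (w ! j) ^ c = (w ! j) ^ c * x ^ e 0"
      by (metis power_commuting_commutes)
    ultimately show ?thesis
      by (simp add: Suc ordered_product_Cons mult.assoc[symmetric])
  qed
qed

text \<open>
  All entries of a commuting block enter at the same place, the left end of the block. A polynomial
  relation between entries of the block can therefore be collected there.
\<close>
lemma ordered_product_raise_block:
  assumes w: "\<And>x y. x \<in> set w \<Longrightarrow> y \<in> set w \<Longrightarrow> x * y = y * x" and i: "i < length w"
    and s: "s = length pre + i"
  shows "ordered_product (pre @ w @ post) (e(s := e s + c)) =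
    ordered_product pre e * ((w ! i) ^ c * ordered_product (w @ post) (\<lambda>j. e (length pre + j)))"
proof -
  let ?e = "\<lambda>j. e (length pre + j)"
  have "(\<lambda>j. (e(s := e s + c)) (length pre + j)) = ?e(i := ?e i + c)"
    by (auto simp: s)
  then have "ordered_product w (\<lambda>j. (e(s := e s + c)) (length pre + j))
      = (w ! i) ^ c * ordered_product w ?e"
    using ordered_product_raise_commuting[OF w i, of ?e c] by simp
  moreover have "ordered_product pre (e(s := e s + c)) = ordered_product pre e"
    by (rule ordered_product_cong) (simp add: s)
  moreover have "ordered_product post (\<lambda>j. (e(s := e s + c)) (length pre + (length w + j)))
      = ordered_product post (\<lambda>j. ?e (length w + j))"
    using i by (intro ordered_product_cong) (simp add: s)
  ultimately show ?thesis
    by (simp only: ordered_product_append mult.assoc)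
qed


section \<open>Functionals on polynomials\<close>

text \<open>
  The left linear functional with value \<open>\<phi> e\<close> on the monomial with exponent vector \<open>e\<close>. Exponent
  vectors are plain functions here, so that shifts become function updates and the exponents of a
  sublist of variables can be passed on as an arbitrary function.
\<close>
definition pairing :: "((nat \<Rightarrow> nat) \<Rightarrow> quat) \<Rightarrow> qpoly \<Rightarrow> quat" where
  "pairing \<phi> f = (\<Sum>m \<in> Poly_Mapping.keys f.
     Poly_Mapping.lookup f m * \<phi> (Poly_Mapping.lookup m))"

lemma eval_poly_eq_pairing:
  "length a = n \<Longrightarrow> eval_poly n f a = pairing (ordered_product a) f"
  by (simp add: eval_poly_def pairing_def ordered_product_def)

lemma pairing_superset:
  assumes "finite S" "Poly_Mapping.keys f \<subseteq> S"
  shows "pairing \<phi> f = (\<Sum>m\<in>S. Poly_Mapping.lookup f m * \<phi> (Poly_Mapping.lookup m))"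
  unfolding pairing_def using assms by (intro sum.mono_neutral_left) (auto simp: in_keys_iff)

lemma pairing_add: "pairing \<phi> (f + g) = pairing \<phi> f + pairing \<phi> g"
proof -
  let ?S = "Poly_Mapping.keys f \<union> Poly_Mapping.keys g"
  have "Poly_Mapping.keys (f + g) \<subseteq> ?S" by (rule Poly_Mapping.keys_add)
  then show ?thesis
    using pairing_superset[of ?S f \<phi>] pairing_superset[of ?S g \<phi>] pairing_superset[of ?S "f + g" \<phi>]
    by (simp add: lookup_add distrib_right sum.distrib)
qed

lemma pairing_single [simp]:
  "pairing \<phi> (Poly_Mapping.single m c) = c * \<phi> (Poly_Mapping.lookup m)"
  by (cases "c = 0") (simp_all add: pairing_def)

lemma pairing_plus_fun: "pairing (\<lambda>e. \<phi> e + \<psi> e) f = pairing \<phi> f + pairing \<psi> f"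
  by (simp add: pairing_def distrib_left sum.distrib)

lemma pairing_mult_right: "pairing (\<lambda>e. \<phi> e * c) f = pairing \<phi> f * c"
  by (simp add: pairing_def sum_distrib_right mult.assoc)

lemma qpoly_induct [case_names single add]:
  fixes f :: qpoly
  assumes "\<And>m c. P (Poly_Mapping.single m c)" and "\<And>f g. P f \<Longrightarrow> P g \<Longrightarrow> P (f + g)"
  shows "P f"
proof (induction f rule: update_induct)
  case const
  show ?case using assms(1)[of 0 0] by simp
next
  case (update f m c)
  have "Poly_Mapping.update m c f = f + Poly_Mapping.single m c"
    using update(1)
    by (intro poly_mapping_eqI) (auto simp: lookup_update lookup_add lookup_single in_keys_iff)
  then show ?case using assms update by simp
qed

lemma lookup_add_variable:
  fixes m :: "nat \<Rightarrow>\<^sub>0 nat"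
  shows "Poly_Mapping.lookup (Poly_Mapping.single s c + m)
     = (Poly_Mapping.lookup m)(s := Poly_Mapping.lookup m s + c)"
  by (auto simp: lookup_add lookup_single fun_eq_iff when_def add.commute)

lemma pairing_mult_variable:
  "pairing \<phi> (Poly_Mapping.single (Poly_Mapping.single s 1) 1 * f)
     = pairing (\<lambda>e. \<phi> (e(s := Suc (e s)))) f"
proof (induction f rule: qpoly_induct)
  case (single m c)
  show ?case
    unfolding mult_single pairing_single lookup_add_variable by simp
next
  case (add f g)
  then show ?case by (simp add: distrib_left pairing_add)
qed


section \<open>The multisphere lies in the hull\<close>

definition annihilates :: "((nat \<Rightarrow> nat) \<Rightarrow> quat) \<Rightarrow> qpoly set \<Rightarrow> bool" where
  "annihilates \<phi> I \<longleftrightarrow> (\<forall>f\<in>I. pairing \<phi> f = 0)"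

lemma annihilates_raise:
  assumes "left_ideal n I" "s < n" "annihilates \<phi> I"
  shows "annihilates (\<lambda>e. \<phi> (e(s := Suc (e s)))) I"
proof -
  have "(Poly_Mapping.single (Poly_Mapping.single s 1) 1 :: qpoly) \<in> poly_ring n"
    using assms(2) by (simp add: poly_ring_def)
  then show ?thesis
    using assms unfolding annihilates_def left_ideal_def pairing_mult_variable[symmetric] by blast
qed

lemma annihilates_plus:
  "annihilates \<phi> I \<Longrightarrow> annihilates \<psi> I \<Longrightarrow> annihilates (\<lambda>e. \<phi> e + \<psi> e) I"
  by (simp add: annihilates_def pairing_plus_fun)

lemma annihilates_mult_right:
  "annihilates \<phi> I \<Longrightarrow> annihilates (\<lambda>e. \<phi> e * c) I"
  by (simp add: annihilates_def pairing_mult_right)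

text \<open>
  At the cut between \<open>A\<close> and \<open>B\<close>, the shift in the variable \<open>s\<close> inserts \<open>u\<close> and the shift in \<open>t\<close>
  inserts \<open>w\<close>. Together they insert a real basis of the quaternions, and real scalars at the cut can
  be moved to the right end, where every scalar is allowed.
\<close>
lemma annihilates_insert:
  assumes I: "left_ideal n I" and st: "s < n" "t < n"
    and ann: "annihilates (\<lambda>e. A e * B e) I"
    and A: "\<And>e. A (e(s := Suc (e s))) = A e * u" "\<And>e. A (e(t := Suc (e t))) = A e"
    and B: "\<And>e. B (e(t := Suc (e t))) = w * B e" "\<And>e. B (e(s := Suc (e s))) = B e"
    and uw: "u * w \<noteq> w * u"
  shows "annihilates (\<lambda>e. A e * (p * B e)) I"
proof -
  obtain a b c d where p: "p = real_quat a + real_quat b * u + real_quat c * w + real_quat d * (u * w)"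
    using uw by (rule noncommuting_quats_span)
  have u: "annihilates (\<lambda>e. A e * (u * B e)) I"
    using annihilates_raise[OF I st(1) ann] by (simp add: A B mult.assoc)
  have w: "annihilates (\<lambda>e. A e * (w * B e)) I"
    using annihilates_raise[OF I st(2) ann] by (simp add: A B)
  have uw: "annihilates (\<lambda>e. A e * (u * (w * B e))) I"
    using annihilates_raise[OF I st(2) u] by (simp add: A B)
  have "A e * (p * B e) = A e * B e * real_quat a + A e * (u * B e) * real_quat b
      + A e * (w * B e) * real_quat c + A e * (u * (w * B e)) * real_quat d" for e
    by (simp add: p distrib_left distrib_right mult.assoc real_quat_commute_left
        flip: real_quat_commute)
  then show ?thesis
    by (simp only:) (intro annihilates_plus annihilates_mult_right ann u w uw)
qed

text \<open>
  The blocks \<open>us\<close> are still those of \<open>v\<close>, the blocks \<open>ws\<close> have been replaced by conjugates. The free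
  factor \<open>p\<close> between them is what lets the induction proceed: to conjugate the next block by \<open>q\<close>, the
  factor on its right is chosen as \<open>inverse q\<close>, and the one on its left as \<open>p * q\<close>.
  Only the last entry of \<open>us\<close> and the original next block are compared, so it does not matter that
  the conjugated blocks may well commute with their neighbours.
\<close>
lemma annihilates_spheres:
  assumes I: "left_ideal n I" and v: "annihilates (ordered_product v) I" "length v = n"
    and vs: "central_presentation v (us @ ws)" "us \<noteq> []"
    and bs: "bs \<in> listset (map sphere_of ws)"
  shows "annihilates (\<lambda>e. ordered_product (concat us) e *
     (p * ordered_product (concat bs) (\<lambda>i. e (length (concat us) + i)))) I"
  using vs bs
proof (induction ws arbitrary: us bs p)
  case Nil
  then have "concat us = v" "bs = []"
    by (auto simp: central_presentation_iff)
  then show ?case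
    using annihilates_mult_right[OF v(1), of p] by simp
next
  case (Cons w ws)
  from Cons.prems(3) obtain b bs' where bs: "bs = b # bs'" "b \<in> sphere_of w"
      "bs' \<in> listset (map sphere_of ws)"
    by (auto simp: set_Cons_def)
  then obtain q where q: "q \<noteq> 0" "b = map (\<lambda>x. q * x * inverse q) w"
    by (auto simp: sphere_of_def)
  let ?U = "concat us"
  define l where "l = length ?U"
  define C where "C e = ordered_product (concat bs') (\<lambda>i. e (l + length w + i))" for e
  define B where "B e = ordered_product w (\<lambda>i. e (l + i)) * (inverse q * C e)" for e
  have pres: "\<And>x y. x \<in> set w \<Longrightarrow> y \<in> set w \<Longrightarrow> x * y = y * x" "w \<noteq> []" "last us \<noteq> []"
    "concat us @ w @ concat ws = v"
    using Cons.prems(1,2) unfolding central_presentation_iff by auto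
  obtain us' z where us: "us = us' @ [z]"
    using Cons.prems(2) by (metis rev_exhaust)
  have "\<forall>i. Suc i < length (us @ w # ws) \<longrightarrow> (\<exists>y\<in>set ((us @ w # ws) ! Suc i).
      last ((us @ w # ws) ! i) * y \<noteq> y * last ((us @ w # ws) ! i))"
    using Cons.prems(1) unfolding central_presentation_iff by blast
  from this[rule_format, of "length us'"]
  obtain y where y: "y \<in> set w" "last z * y \<noteq> y * last z"
    by (auto simp: us nth_append)
  have z: "last us = z" "z \<noteq> []"
    using pres(3) by (simp_all add: us)
  have U: "?U \<noteq> []" "last ?U = last z"
    using z by (simp_all add: us)
  obtain j where j: "j < length w" "w ! j = y"
    using y(1) by (auto simp: in_set_conv_nth)
  have l0: "l > 0" using U by (simp add: l_def)
  have ln: "l + length w \<le> n"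
    using v(2) pres(4) by (auto simp: l_def)
  have ann: "annihilates (\<lambda>e. ordered_product ?U e * B e) I"
    using Cons.IH[of "us @ [w]" bs' "inverse q"] Cons.prems(1) bs(3)
    by (simp add: ordered_product_append B_def C_def l_def add.assoc mult.assoc)
  have "annihilates (\<lambda>e. ordered_product ?U e * ((p * q) * B e)) I"
  proof (rule annihilates_insert[OF I _ _ ann, where s = "l - 1" and t = "l + j" and u = "last z" and w = y])
    show "l - 1 < n" "l + j < n" using j l0 ln by auto
    show "ordered_product ?U (e(l - 1 := Suc (e (l - 1)))) = ordered_product ?U e * last z" for e
      using ordered_product_raise_last[OF U(1)] U(2) by (simp add: l_def)
    show "ordered_product ?U (e(l + j := Suc (e (l + j)))) = ordered_product ?U e" for e
      by (rule ordered_product_cong) (simp add: l_def)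
    show "B (e(l + j := Suc (e (l + j)))) = y * B e" for e
    proof -
      let ?e = "\<lambda>i. e (l + i)"
      have "(\<lambda>i. (e(l + j := Suc (e (l + j)))) (l + i)) = ?e(j := ?e j + 1)" by auto
      moreover have "ordered_product w (?e(j := ?e j + 1)) = y * ordered_product w ?e"
        using ordered_product_raise_commuting[of w j ?e 1] pres(1) j by simp
      moreover have "C (e(l + j := Suc (e (l + j)))) = C e"
        unfolding C_def using j by (intro ordered_product_cong) simp
      ultimately show ?thesis by (simp add: B_def mult.assoc)
    qed
    show "B (e(l - 1 := Suc (e (l - 1)))) = B e" for e
    proof -
      have "l + i \<noteq> l - 1" for i using l0 by simp
      moreover have "l + length w + i \<noteq> l - 1" for i using l0 by simp
      ultimately show ?thesis by (simp add: B_def C_def)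
    qed
    show "last z * y \<noteq> y * last z" by (rule y(2))
  qed
  moreover have "(p * q) * B e = p * ordered_product (concat bs) (\<lambda>i. e (length ?U + i))" for e
    by (simp only: bs(1) q(2) concat.simps length_map ordered_product_append
        ordered_product_conj[OF q(1)] B_def C_def l_def add.assoc) (simp only: mult.assoc)
  ultimately show ?case by simp
qed

lemma multisphere_subset_hull:
  assumes v: "length v = n" and vs: "central_presentation v (v0 # ws)"
    and bs: "bs \<in> listset (map sphere_of ws)"
  shows "v0 @ concat bs \<in> algebraic_hull n v"
  unfolding algebraic_hull_def
proof (intro INT_I)
  fix I assume "I \<in> {I. left_ideal n I \<and> v \<in> zero_locus n I}"
  then have I: "left_ideal n I" and ann: "annihilates (ordered_product v) I"
    using v by (auto simp: zero_locus_def annihilates_def eval_poly_eq_pairing)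
  have "length (concat bs) = length (concat ws)"
    using bs
  proof (induction ws arbitrary: bs)
    case (Cons w ws)
    then show ?case by (auto simp: set_Cons_def sphere_of_def)
  qed simp
  then have len: "length (v0 @ concat bs) = n"
    using vs v by (auto simp: central_presentation_iff)
  have "annihilates (ordered_product (v0 @ concat bs)) I"
    using annihilates_spheres[OF I ann v, of "[v0]" ws bs 1] vs bs
    by (simp add: ordered_product_append[abs_def])
  then show "v0 @ concat bs \<in> zero_locus n I"
    using len by (auto simp: zero_locus_def tuples_def annihilates_def eval_poly_eq_pairing)
qed


section \<open>The hull lies in the multisphere\<close>

text \<open>
  The largest left ideal that vanishes at \<open>v\<close>. The polynomials vanishing at \<open>v\<close> do not form a left
  ideal in general, because multiplication by a variable inserts its value inside the ordered
  product.
\<close>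
definition vanishing_ideal :: "nat \<Rightarrow> quat list \<Rightarrow> qpoly set" where
  "vanishing_ideal n v = {f \<in> poly_ring n. \<forall>g. eval_poly n (g * f) v = 0}"

lemma poly_ring_add: "f \<in> poly_ring n \<Longrightarrow> g \<in> poly_ring n \<Longrightarrow> f + g \<in> poly_ring n"
  unfolding poly_ring_def using Poly_Mapping.keys_add[of f g] by blast

lemma poly_ring_mult:
  assumes "f \<in> poly_ring n" "g \<in> poly_ring n"
  shows "f * g \<in> poly_ring n"
  unfolding poly_ring_def
proof (clarify)
  fix m i assume "m \<in> Poly_Mapping.keys (f * g)" "i \<in> Poly_Mapping.keys m"
  then obtain a b where "a \<in> Poly_Mapping.keys f" "b \<in> Poly_Mapping.keys g"
      "i \<in> Poly_Mapping.keys (a + b)"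
    using keys_mult[of f g] by blast
  then show "i < n"
    using assms Poly_Mapping.keys_add[of a b] unfolding poly_ring_def by blast
qed

lemma left_ideal_vanishing_ideal:
  assumes "length v = n"
  shows "left_ideal n (vanishing_ideal n v)"
proof -
  have "(g * f) \<in> vanishing_ideal n v" if "g \<in> poly_ring n" "f \<in> vanishing_ideal n v" for f g
    using that by (simp add: vanishing_ideal_def poly_ring_mult mult.assoc[symmetric])
  moreover have "f + g \<in> vanishing_ideal n v"
    if "f \<in> vanishing_ideal n v" "g \<in> vanishing_ideal n v" for f g
    using that assms
    by (simp add: vanishing_ideal_def poly_ring_add distrib_left eval_poly_eq_pairing pairing_add)
  moreover have "0 \<in> vanishing_ideal n v"
    by (simp add: vanishing_ideal_def poly_ring_def eval_poly_def)
  moreover have "vanishing_ideal n v \<subseteq> poly_ring n"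
    by (auto simp: vanishing_ideal_def)
  ultimately show ?thesis
    unfolding left_ideal_def by blast
qed

lemma hull_vanishing:
  assumes "length v = n" "a \<in> algebraic_hull n v" "f \<in> vanishing_ideal n v"
  shows "eval_poly n f a = 0"
proof -
  have "eval_poly n g v = 0" if "g \<in> vanishing_ideal n v" for g
  proof -
    have "eval_poly n (1 * g) v = 0" using that unfolding vanishing_ideal_def by blast
    then show ?thesis by simp
  qed
  then have "v \<in> zero_locus n (vanishing_ideal n v)"
    using assms(1) by (simp add: zero_locus_def tuples_def)
  then have "a \<in> zero_locus n (vanishing_ideal n v)"
    using assms(2) left_ideal_vanishing_ideal[OF assms(1)] unfolding algebraic_hull_def by blast
  then show ?thesis
    using assms(3) by (simp add: zero_locus_def)
qed

lemma length_hull: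
  assumes "length v = n" "a \<in> algebraic_hull n v"
  shows "length a = n"
proof -
  have "left_ideal n {0}" by (simp add: left_ideal_def poly_ring_def)
  moreover have "v \<in> zero_locus n {0}"
    using assms(1) by (simp add: zero_locus_def tuples_def eval_poly_def)
  ultimately show ?thesis
    using assms(2) by (auto simp: algebraic_hull_def zero_locus_def tuples_def)
qed

text \<open>
  The left hand side of the relation, read as a polynomial, lies in the vanishing ideal: in its
  product with any monomial, the coefficients move past the product over \<open>pre\<close>, and the relation
  appears as a factor. The condition on the coefficients holds when they are real, and it holds for
  all coefficients when \<open>pre\<close> is empty; these are the two uses.
\<close>
lemma hull_relation:
  assumes v: "v = pre @ w @ post" "length v = n" and a: "a \<in> algebraic_hull n v"
    and w: "\<And>x y. x \<in> set w \<Longrightarrow> y \<in> set w \<Longrightarrow> x * y = y * x"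
    and ij: "i < length w" "j < length w"
    and cent: "\<And>d e. d \<in> {A, B, C, D} \<Longrightarrow> d * ordered_product pre e = ordered_product pre e * d"
    and rel: "A * (w ! i * w ! i) + B * w ! i + C * w ! j + D = 0"
  defines "s \<equiv> length pre + i" and "t \<equiv> length pre + j"
  shows "A * (a ! s * a ! s) + B * a ! s + C * a ! t + D = 0"
proof -
  let ?x = "\<lambda>s k. Poly_Mapping.single s k"
  define f :: qpoly where "f = Poly_Mapping.single (?x s 2) A + Poly_Mapping.single (?x s 1) B
    + Poly_Mapping.single (?x t 1) C + Poly_Mapping.single 0 D"
  have st: "s < n" "t < n" using v ij by (auto simp: s_def t_def)
  have "pairing (ordered_product v) (g * f) = 0" for g
  proof (induction g rule: qpoly_induct)
    case (single m c)
    let ?e = "Poly_Mapping.lookup m"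
    let ?P = "ordered_product pre ?e" and ?Q = "ordered_product (w @ post) (\<lambda>j. ?e (length pre + j))"
    have raise: "ordered_product v (Poly_Mapping.lookup (m + ?x s k)) = ?P * ((w ! i) ^ k * ?Q)"
        "ordered_product v (Poly_Mapping.lookup (m + ?x t k)) = ?P * ((w ! j) ^ k * ?Q)" for k
      unfolding add.commute[of m] lookup_add_variable v(1)
      using ordered_product_raise_block[OF w ij(1) s_def[THEN meta_eq_to_obj_eq], where post = post and e = ?e and c = k]
        ordered_product_raise_block[OF w ij(2) t_def[THEN meta_eq_to_obj_eq], where post = post and e = ?e and c = k]
      by simp_all
    have c: "A * (?P * z) = ?P * (A * z)" "B * (?P * z) = ?P * (B * z)"
        "C * (?P * z) = ?P * (C * z)" "D * (?P * z) = ?P * (D * z)" for z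
      using cent[of _ ?e] by (simp_all add: mult.assoc[symmetric])
    have "ordered_product v ?e = ?P * ?Q"
      by (simp add: v(1) ordered_product_append)
    then have "pairing (ordered_product v) (Poly_Mapping.single m c * f)
      = c * (?P * ((A * (w ! i * w ! i) + B * w ! i + C * w ! j + D) * ?Q))"
      by (simp add: f_def distrib_left distrib_right pairing_add mult_single raise c mult.assoc
          power2_eq_square)
    then show ?case by (simp add: rel)
  next
    case (add g h)
    then show ?case by (simp add: distrib_right pairing_add)
  qed
  moreover have "f \<in> poly_ring n"
    unfolding f_def using st by (intro poly_ring_add) (auto simp: poly_ring_def)
  ultimately have "f \<in> vanishing_ideal n v"
    using v(2) by (simp add: vanishing_ideal_def eval_poly_eq_pairing)
  then have "pairing (ordered_product a) f = 0"
    using hull_vanishing[OF v(2) a] length_hull[OF v(2) a] by (simp add: eval_poly_eq_pairing)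
  moreover have "ordered_product a (Poly_Mapping.lookup (?x r k)) = (a ! r) ^ k" if "r < n" for r k
  proof -
    have r: "r < length a" using that length_hull[OF v(2) a] by simp
    then have "a = take r a @ [a ! r] @ drop (Suc r) a" by (simp add: id_take_nth_drop)
    then have "ordered_product a ((\<lambda>i. 0)(r := 0 + k))
       = ordered_product (take r a @ [a ! r] @ drop (Suc r) a) ((\<lambda>i. 0)(r := 0 + k))"
      by (rule arg_cong)
    also have "\<dots> = (a ! r) ^ k"
      using ordered_product_raise_block[of "[a ! r]" 0 r "take r a" "drop (Suc r) a" "\<lambda>i. 0" k] r
      by simp
    finally have "ordered_product a ((\<lambda>i. 0)(r := 0 + k)) = (a ! r) ^ k" .
    moreover have "Poly_Mapping.lookup (?x r k) = (\<lambda>i. 0)(r := 0 + k)"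
      by (auto simp: lookup_single when_def)
    ultimately show ?thesis by simp
  qed
  moreover have "Poly_Mapping.lookup 0 = (\<lambda>i::nat. 0::nat)" by auto
  ultimately show ?thesis
    using st by (simp add: f_def pairing_add power2_eq_square)
qed

text \<open>
  If all entries of \<open>w\<close> are real, the linear relations fix \<open>b\<close>. Otherwise one nonreal entry is conjugate
  to its counterpart in \<open>b\<close> by the quadratic relation, and all other entries are real affine functions
  of it, so the same conjugation serves for them.
\<close>
lemma in_sphere_if_relations:
  assumes len: "length b = length w" and w: "\<And>x y. x \<in> set w \<Longrightarrow> y \<in> set w \<Longrightarrow> x * y = y * x"
    and rel: "\<And>i j A B C D. i < length w \<Longrightarrow> j < length w \<Longrightarrow>
      real_quat A * (w ! i * w ! i) + real_quat B * w ! i + real_quat C * w ! j + real_quat D = 0 \<Longrightarrow>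
      real_quat A * (b ! i * b ! i) + real_quat B * b ! i + real_quat C * b ! j + real_quat D = 0"
  shows "b \<in> sphere_of w"
proof (cases "\<forall>x\<in>set w. x = real_quat (qRe x)")
  case True
  have "b ! i = w ! i" if i: "i < length w" for i
  proof -
    have r: "w ! i = real_quat (qRe (w ! i))" using True i nth_mem by blast
    show ?thesis
      using rel[OF i i, of 0 1 0 "- qRe (w ! i)"] r
      by (cases "b ! i"; cases "w ! i") (auto simp: quat_ops_defs)
  qed
  then have "b = w" using len by (simp add: list_eq_iff_nth_eq)
  then show ?thesis
    unfolding sphere_of_def by (auto intro!: exI[of _ 1])
next
  case False
  then obtain i where i: "i < length w" and nonreal: "w ! i \<noteq> real_quat (qRe (w ! i))"
    by (metis in_set_conv_nth)
  have one: "real_quat 1 = 1" and zero: "real_quat 0 = 0"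
    by (simp_all add: one_quat_def zero_quat_def)
  have "b ! i * b ! i + real_quat (- 2 * qRe (w ! i)) * b ! i + real_quat (sq_norm (w ! i)) = 0"
    using rel[OF i i, of 1 "- 2 * qRe (w ! i)" 0 "sq_norm (w ! i)"] quat_quadratic[of "w ! i"]
    by (simp add: one zero)
  then obtain q where q: "q \<noteq> 0" "b ! i = q * w ! i * inverse q"
    using conjugate_if_root[OF nonreal] by blast
  have "b ! j = q * w ! j * inverse q" if j: "j < length w" for j
  proof -
    obtain \<alpha> \<beta> where ab: "w ! j = real_quat \<alpha> + real_quat \<beta> * w ! i"
      using commuting_with_nonreal[OF w nonreal, of "w ! j"] i j by auto
    have neg: "real_quat (- r) = - real_quat r" for r by (simp add: uminus_quat_def)
    have "- (real_quat \<beta> * b ! i) + b ! j - real_quat \<alpha> = 0"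
      using rel[OF i j, of 0 "- \<beta>" 1 "- \<alpha>"] by (simp add: one zero neg ab)
    moreover have "b ! j = (- (real_quat \<beta> * b ! i) + b ! j - real_quat \<alpha>)
        + (real_quat \<alpha> + real_quat \<beta> * b ! i)"
      by simp
    ultimately have "b ! j = real_quat \<alpha> + real_quat \<beta> * b ! i"
      by simp
    also have "\<dots> = q * w ! j * inverse q"
    proof -
      have "q * real_quat \<alpha> * inverse q = real_quat \<alpha>"
        using q(1) by (simp add: real_quat_commute[symmetric] mult.assoc)
      then show ?thesis
        by (simp add: ab q(2) distrib_left distrib_right mult.assoc real_quat_commute_left)
    qed
    finally show ?thesis .
  qed
  then have "b = map (\<lambda>x. q * x * inverse q) w"
    using len by (simp add: list_eq_iff_nth_eq)
  then show ?thesis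
    using q(1) unfolding sphere_of_def by blast
qed

lemma hull_block_in_sphere:
  assumes v: "v = pre @ w @ post" "length v = n" and a: "a \<in> algebraic_hull n v"
    and w: "\<And>x y. x \<in> set w \<Longrightarrow> y \<in> set w \<Longrightarrow> x * y = y * x"
  shows "take (length w) (drop (length pre) a) \<in> sphere_of w"
proof (rule in_sphere_if_relations[OF _ w])
  have len: "length a = n" using v(2) a by (rule length_hull)
  then show "length (take (length w) (drop (length pre) a)) = length w"
    using v by simp
  fix i j A B C D
  assume "i < length w" "j < length w"
    "real_quat A * (w ! i * w ! i) + real_quat B * w ! i + real_quat C * w ! j + real_quat D = 0"
  then show "real_quat A * (take (length w) (drop (length pre) a) ! i * take (length w) (drop (length pre) a) ! i)
     + real_quat B * take (length w) (drop (length pre) a) ! i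
     + real_quat C * take (length w) (drop (length pre) a) ! j + real_quat D = 0"
    using hull_relation[OF v a w, of i j "real_quat A" "real_quat B" "real_quat C" "real_quat D"]
      real_quat_commute v len
    by auto
qed

lemma hull_first_block:
  assumes v: "v = w @ post" "length v = n" and a: "a \<in> algebraic_hull n v"
    and w: "\<And>x y. x \<in> set w \<Longrightarrow> y \<in> set w \<Longrightarrow> x * y = y * x"
  shows "take (length w) a = w"
proof (rule nth_equalityI)
  have len: "length a = n" using v(2) a by (rule length_hull)
  then show "length (take (length w) a) = length w"
    using v by simp
  fix i assume "i < length (take (length w) a)"
  then have i: "i < length w" by simp
  then show "take (length w) a ! i = w ! i"
    using hull_relation[of v "[]" w post n a i i 0 1 0 "- (w ! i)"] v a w by simp
qed

lemma concat_listset_if_blocks: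
  assumes "length a = length (concat ws)"
    and "\<And>us w zs. ws = us @ w # zs \<Longrightarrow> take (length w) (drop (length (concat us)) a) \<in> S w"
  shows "a \<in> concat ` listset (map S ws)"
  using assms
proof (induction ws arbitrary: a)
  case Nil
  then show ?case by simp
next
  case (Cons w ws)
  have "take (length w) a \<in> S w"
    using Cons.prems(2)[of "[]" w ws] by simp
  moreover have "drop (length w) a \<in> concat ` listset (map S ws)"
  proof (rule Cons.IH)
    show "length (drop (length w) a) = length (concat ws)" using Cons.prems(1) by simp
    fix us w' zs assume "ws = us @ w' # zs"
    then show "take (length w') (drop (length (concat us)) (drop (length w) a)) \<in> S w'"
      using Cons.prems(2)[of "w # us" w' zs] by (simp add: add.commute)
  qed
  then obtain bs where "bs \<in> listset (map S ws)" "drop (length w) a = concat bs"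
    by blast
  ultimately show ?case
    by (auto simp: set_Cons_def intro!: image_eqI[of _ _ "take (length w) a # bs"])
       (metis append_take_drop_id)
qed

lemma hull_subset_multisphere:
  assumes v: "length v = n" and vs: "central_presentation v (v0 # ws)"
    and a: "a \<in> algebraic_hull n v"
  shows "a \<in> concat ` listset ({v0} # map sphere_of ws)"
proof -
  have comm: "\<And>x y. x \<in> set w \<Longrightarrow> y \<in> set w \<Longrightarrow> x * y = y * x" if "w \<in> set (v0 # ws)" for w
    using vs that unfolding central_presentation_iff by blast
  have cv: "v = v0 @ concat ws" using vs by (simp add: central_presentation_iff)
  have len: "length a = n" using v a by (rule length_hull)
  have first: "take (length v0) a = v0"
    using hull_first_block[OF cv v a] comm[of v0] by simp
  have "drop (length v0) a \<in> concat ` listset (map sphere_of ws)"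
  proof (rule concat_listset_if_blocks)
    show "length (drop (length v0) a) = length (concat ws)" using len v cv by simp
    fix us w zs assume "ws = us @ w # zs"
    then show "take (length w) (drop (length (concat us)) (drop (length v0) a)) \<in> sphere_of w"
      using hull_block_in_sphere[of v "v0 @ concat us" w "concat zs" n a] comm[of w] cv v a
      by (simp add: add.commute)
  qed
  then obtain bs where "bs \<in> listset (map sphere_of ws)" "drop (length v0) a = concat bs"
    by blast
  then show ?thesis
    using first
    by (auto simp: set_Cons_def intro!: image_eqI[of _ _ "v0 # bs"]) (metis append_take_drop_id)
qed

section \<open>The hull is the multisphere\<close>

theorem theorem4p4:
  fixes n :: nat and v :: "quat list"
  assumes "n \<ge> 1" and "v \<in> tuples n"
  shows "algebraic_hull n v = enveloping_multisphere v"
proof -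
  have len: "length v = n" using assms(2) by (simp add: tuples_def)
  then have "v \<noteq> []" using assms(1) by auto
  define vs where "vs = (THE vs. central_presentation v vs)"
  have cp: "central_presentation v vs"
    unfolding vs_def by (rule theI', rule central_presentation_exists_unique) fact
  then obtain v0 ws where vs: "vs = v0 # ws"
    by (cases vs) (auto simp: central_presentation_iff)
  have B: "enveloping_multisphere v = concat ` listset ({v0} # map sphere_of ws)"
    unfolding enveloping_multisphere_def Let_def vs_def[symmetric] by (simp add: vs)
  show ?thesis
  proof
    show "algebraic_hull n v \<subseteq> enveloping_multisphere v"
      using hull_subset_multisphere[OF len cp[unfolded vs]] B by blast
    show "enveloping_multisphere v \<subseteq> algebraic_hull n v"
      using multisphere_subset_hull[OF len cp[unfolded vs]] by (auto simp: B set_Cons_def)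
  qed
qed

end
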